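(* Let $P:\mathbb{R}\to\mathbb{R}$ be a continuous map such that $P((-\infty,0])=[0,\infty)$, $P(0)=0$, $P$ is two-to-one except at $0$, and $P$ is the identity on $[0,\infty)$. Let $H^-:=\{(x,y)\in\mathbb{R}^2\mid y<0\}$. Then there exists a flow $\Phi$ on $\mathbb{R}^2$ such that $(P(x),0)=E^{\Phi}_{H^-}(x,0)$ for all $x\in\mathbb{R}$, where $E^{\Phi}_{H^-}$ is the first-out map of $\Phi$ for $H^-$.
   Context: A flow on a topological space $X$ is a continuous map $\Phi:\mathbb{R}\times X\to X$ with $\Phi(0,x)=x$ and $\Phi(s+t,x)=\Phi(s,\Phi(t,x))$. First-out map: for an open set $A\subset X$, $E^\Phi_A:\partial A\to\partial A$ is the partial map $E^\Phi_A(x)=\Phi(T^e_A(x),x)$, where $T^e_A(x)=\inf\{t>0\mid\Phi(t,x)\notin A\}$; it is defined at $x$ iff this set of times is nonempty. "Two-to-one except at $0$" means that every value in the image of $P$ other than $0$ has exactly two preimages, while $0$ has the single preimage $0$. *)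

theory Defs
  imports "HOL-Analysis.Analysis"
begin

definition flow :: "(real \<times> 'a::topological_space \<Rightarrow> 'a) \<Rightarrow> bool" where
  "flow \<Phi> \<longleftrightarrow>
     continuous_on UNIV \<Phi> \<and>
     (\<forall>x. \<Phi> (0, x) = x) \<and>
     (\<forall>s t x. \<Phi> (s + t, x) = \<Phi> (s, \<Phi> (t, x)))"

definition out_times :: "(real \<times> 'a \<Rightarrow> 'a) \<Rightarrow> 'a set \<Rightarrow> 'a \<Rightarrow> real set" where
  "out_times \<Phi> A x = {t. t > 0 \<and> \<Phi> (t, x) \<notin> A}"

definition first_out_time :: "(real \<times> 'a \<Rightarrow> 'a) \<Rightarrow> 'a set \<Rightarrow> 'a \<Rightarrow> real" where
  "first_out_time \<Phi> A x = Inf (out_times \<Phi> A x)"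

text \<open>
  The first-out map is a partial map from the frontier of the open set \<open>A\<close> to itself.
  It is \<open>None\<close> off the frontier of \<open>A\<close>, and also at frontier points whose forward orbit
  lies in \<open>A\<close> at all positive times. The infimum is taken over strictly positive times,
  so the exit time may be \<open>0\<close>, in which case the point is mapped to itself.
\<close>

definition first_out_map ::
  "(real \<times> 'a::topological_space \<Rightarrow> 'a) \<Rightarrow> 'a set \<Rightarrow> 'a \<rightharpoonup> 'a" where
  "first_out_map \<Phi> A x =
     (if x \<in> frontier A \<and> out_times \<Phi> A x \<noteq> {}
      then Some (\<Phi> (first_out_time \<Phi> A x, x)) else None)"

definition two_to_one_except_at_zero :: "(real \<Rightarrow> real) \<Rightarrow> bool" where
  "two_to_one_except_at_zero P \<longleftrightarrow>
     (\<forall>y \<in> range P. y \<noteq> 0 \<longrightarrow> card (P -` {y}) = 2) \<and> P -` {0} = {0}"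

definition lower_half_plane :: "(real \<times> real) set" where
  "lower_half_plane = {(x, y). y < 0}"

end

theory Submission
  imports Defs
begin

text \<open>
  The counterclockwise rotation flow carries a point \<open>(a, 0)\<close> with \<open>a < 0\<close> through the lower half
  plane to \<open>(-a, 0)\<close>, while for \<open>a \<ge> 0\<close> the exit time is \<open>0\<close>; so its first-out map on the axis is
  the absolute value. The hypotheses say that \<open>P\<close> maps the negative half line homeomorphically onto
  the positive one, so \<open>P\<close> is the absolute value conjugated by the homeomorphism that is \<open>-P\<close> on
  the negative half line and the identity on the positive one. Conjugating the rotation by it in
  the first coordinate gives the flow.
\<close>

lemma axis_in_frontier_lower_half_plane: "(x, 0) \<in> frontier lower_half_plane"
proof -
  have half_plane: "lower_half_plane = UNIV \<times> {..<0}"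
    by (auto simp: lower_half_plane_def)
  show ?thesis
    by (simp add: half_plane frontier_def closure_Times interior_Times interior_open)
qed

text \<open>By \<open>inside\<close>, \<open>s\<close> is a lower bound of the out times; by
  \<open>outside\<close>, no larger number is one. The latter asks for out times arbitrarily close
  to \<open>s\<close> from above, not at \<open>s\<close>, so that \<open>s = 0\<close> is covered:
  time 0 is never an out time.\<close>

lemma first_out_map_eq_SomeI:
  assumes "x \<in> frontier A"
    and "s \<ge> 0"
    and inside: "\<And>t. 0 < t \<Longrightarrow> t < s \<Longrightarrow> \<Phi> (t, x) \<in> A"
    and outside: "\<And>\<epsilon>. \<epsilon> > 0 \<Longrightarrow> \<exists>t>0. s \<le> t \<and> t < s + \<epsilon> \<and> \<Phi> (t, x) \<notin> A"
  shows "first_out_map \<Phi> A x = Some (\<Phi> (s, x))"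
proof -
  have nonempty: "out_times \<Phi> A x \<noteq> {}"
    using outside[of 1] by (auto simp: out_times_def)
  have "Inf (out_times \<Phi> A x) = s"
  proof (rule cInf_eq_non_empty[OF nonempty])
    fix t assume "t \<in> out_times \<Phi> A x"
    then show "s \<le> t"
      using inside[of t] by (force simp: out_times_def)
  next
    fix y assume lower: "\<And>t. t \<in> out_times \<Phi> A x \<Longrightarrow> y \<le> t"
    show "y \<le> s"
    proof (rule ccontr)
      assume "\<not> y \<le> s"
      then obtain t where "t > 0" "t < s + (y - s)" "\<Phi> (t, x) \<notin> A"
        using outside[of "y - s"] by auto
      then show False
        using lower[of t] by (auto simp: out_times_def)
    qed
  qed
  then show ?thesis
    using assms(1) nonempty by (simp add: first_out_map_def first_out_time_def)
qed

text \<open>Rotation by the angle \<open>t\<close> in the coordinates \<open>(g x, y)\<close>, with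
  \<open>h\<close> in the role of the inverse of \<open>g\<close>. Since \<open>y\<close> is left
  alone, the change of coordinates preserves the lower half plane and its boundary.\<close>

definition conjugated_rotation ::
  "(real \<Rightarrow> real) \<Rightarrow> (real \<Rightarrow> real) \<Rightarrow> real \<times> (real \<times> real) \<Rightarrow> real \<times> real" where
  "conjugated_rotation g h = (\<lambda>(t, x, y).
     (h (g x * cos t - y * sin t), g x * sin t + y * cos t))"

lemma flow_conjugated_rotation:
  assumes "homeomorphism UNIV UNIV g h"
  shows "flow (conjugated_rotation g h)"
  unfolding flow_def
proof (intro conjI allI)
  have gc: "continuous_on UNIV g" and hc: "continuous_on UNIV h"
    and gh: "\<And>y. g (h y) = y" and hg: "\<And>x. h (g x) = x"
    using assms by (auto simp: homeomorphism_def)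
  show "continuous_on UNIV (conjugated_rotation g h)"
    unfolding conjugated_rotation_def split_def
    by (intro continuous_intros continuous_on_compose2[OF gc] continuous_on_compose2[OF hc]) auto
  show "conjugated_rotation g h (0, p) = p" for p
    by (cases p) (simp add: conjugated_rotation_def hg)
  show "conjugated_rotation g h (s + t, p)
      = conjugated_rotation g h (s, conjugated_rotation g h (t, p))" for s t p
    by (cases p) (simp add: conjugated_rotation_def gh cos_add sin_add algebra_simps)
qed

lemma first_out_map_conjugated_rotation:
  assumes "\<And>x. h (g x) = x"
  shows "first_out_map (conjugated_rotation g h) lower_half_plane (x, 0) = Some (h \<bar>g x\<bar>, 0)"
proof -
  have rotate_axis: "conjugated_rotation g h (t, x, 0) = (h (g x * cos t), g x * sin t)" for t
    by (simp add: conjugated_rotation_def)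
  have inside_iff: "conjugated_rotation g h (t, x, 0) \<in> lower_half_plane \<longleftrightarrow> g x * sin t < 0" for t
    by (simp add: rotate_axis lower_half_plane_def)
  show ?thesis
  proof (cases "g x < 0")
    case True
    have "first_out_map (conjugated_rotation g h) lower_half_plane (x, 0)
        = Some (conjugated_rotation g h (pi, x, 0))"
    proof (rule first_out_map_eq_SomeI[OF axis_in_frontier_lower_half_plane])
      show "conjugated_rotation g h (t, x, 0) \<in> lower_half_plane" if "0 < t" "t < pi" for t
        using True that by (simp add: inside_iff mult_neg_pos sin_gt_zero)
      show "\<exists>t>0. pi \<le> t \<and> t < pi + \<epsilon> \<and> conjugated_rotation g h (t, x, 0) \<notin> lower_half_plane"
        if "\<epsilon> > 0" for \<epsilon>
        using that by (intro exI[of _ pi]) (simp add: inside_iff)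
    qed simp
    then show ?thesis
      using True by (simp add: rotate_axis)
  next
    case False
    have "first_out_map (conjugated_rotation g h) lower_half_plane (x, 0)
        = Some (conjugated_rotation g h (0, x, 0))"
    proof (rule first_out_map_eq_SomeI[OF axis_in_frontier_lower_half_plane])
      \<comment> \<open>The witness is positive and below \<open>\<epsilon>\<close>, and the cap at
        \<open>pi\<close> keeps its sine nonnegative.\<close>
      show "\<exists>t>0. 0 \<le> t \<and> t < 0 + \<epsilon> \<and> conjugated_rotation g h (t, x, 0) \<notin> lower_half_plane"
        if "\<epsilon> > 0" for \<epsilon>
      proof (intro exI[of _ "min (\<epsilon> / 2) pi"] conjI)
        have "sin (min (\<epsilon> / 2) pi) \<ge> 0"
          using that by (intro sin_ge_zero) auto
        then show "conjugated_rotation g h (min (\<epsilon> / 2) pi, x, 0) \<notin> lower_half_plane"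
          using False by (simp add: inside_iff not_less)
      qed (use that in auto)
    qed auto
    then show ?thesis
      using False by (simp add: rotate_axis)
  qed
qed

theorem theoremC:
  fixes P :: "real \<Rightarrow> real"
  assumes "continuous_on UNIV P"
    and "P ` {..0} = {0..}"
    and "P 0 = 0"
    and "two_to_one_except_at_zero P"
    and "\<forall>x\<ge>0. P x = x"
  shows "\<exists>\<Phi> :: real \<times> (real \<times> real) \<Rightarrow> real \<times> real.
           flow \<Phi> \<and> (\<forall>x. first_out_map \<Phi> lower_half_plane (x, 0) = Some (P x, 0))"
proof -
  have P_pos: "P x > 0" if "x < 0" for x
  proof -
    have "P x \<ge> 0"
      using assms(2) that by force
    moreover have "P x \<noteq> 0"
      using assms(4) that by (auto simp: two_to_one_except_at_zero_def vimage_singleton_eq set_eq_iff)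
    ultimately show ?thesis by simp
  qed
  have P_inj: "x = x'" if "x < 0" "x' < 0" "P x = P x'" for x x'
  proof (rule ccontr)
    assume "x \<noteq> x'"
    have card: "card (P -` {P x}) = 2"
      using assms(4) P_pos[OF that(1)] unfolding two_to_one_except_at_zero_def
      by (metis less_irrefl rangeI)
    \<comment> \<open>The identity on the positive half line supplies a further preimage:
      \<open>P x > 0\<close> is fixed by \<open>P\<close>. Two distinct negative preimages would
      thus make three.\<close>
    have "{x, x', P x} \<subseteq> P -` {P x}"
      using that assms(5) P_pos[OF that(1)] by auto
    then have "card {x, x', P x} \<le> 2"
      using card by (metis card_mono card.infinite zero_neq_numeral)
    then show False
      using \<open>x \<noteq> x'\<close> that P_pos[OF that(1)] by auto
  qed

  \<comment> \<open>With \<open>max\<close> and \<open>min\<close> the two branches need no gluing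
    argument for continuity; they fit together because \<open>P 0 = 0\<close>.\<close>
  define g where "g x = max x 0 - P (min x 0)" for x
  have g_neg: "g x = - P x" if "x < 0" for x
    using that by (simp add: g_def)
  have g_nonneg: "g x = x" if "x \<ge> 0" for x
    using that assms(3) by (simp add: g_def)
  have "continuous_on UNIV g"
    unfolding g_def by (intro continuous_intros continuous_on_compose2[OF assms(1)]) auto
  moreover have "inj g"
  proof (rule injI)
    \<comment> \<open>\<open>g\<close> preserves the sign, so \<open>x\<close> and \<open>x'\<close>
      lie on the same side of 0, and \<open>P_inj\<close> settles the negative side.\<close>
    fix x x' assume "g x = g x'"
    then show "x = x'"
      using P_inj[of x x'] P_pos[of x] P_pos[of x'] g_neg[of x] g_neg[of x']
        g_nonneg[of x] g_nonneg[of x'] by linarith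
  qed
  moreover have "y \<in> range g" for y
  proof (cases "y < 0")
    case True
    then have "- y \<in> P ` {..0}"
      using assms(2) by simp
    then obtain x where "x \<le> 0" "- y = P x"
      by blast
    then have "g x = y"
      using True assms(3) g_neg[of x] by (cases "x = 0") auto
    then show ?thesis by blast
  next
    case False
    then show ?thesis
      using g_nonneg[of y] by (metis not_less rangeI)
  qed
  then have "range g = UNIV" by blast
  \<comment> \<open>Continuity of the inverse comes from invariance of domain.\<close>
  ultimately obtain h where homeo: "homeomorphism UNIV UNIV g h"
    using invariance_of_domain_homeomorphism[of UNIV g] by auto
  then have hg: "h (g x) = x" for x
    by (simp add: homeomorphism_def)

  have "h \<bar>g x\<bar> = P x" for x
  proof (cases "x < 0")
    case True
    \<comment> \<open>\<open>P x\<close> is positive, where \<open>g\<close> is the identity, so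
      \<open>h\<close> returns it unchanged.\<close>
    then have "\<bar>g x\<bar> = g (P x)"
      using g_neg[of x] g_nonneg[of "P x"] P_pos[of x] by simp
    then show ?thesis by (simp add: hg)
  next
    case False
    then show ?thesis
      using assms(5) g_nonneg[of x] hg[of x] by simp
  qed
  then show ?thesis
    using flow_conjugated_rotation[OF homeo] first_out_map_conjugated_rotation[of h g, OF hg]
    by metis
qed

end
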